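(* For every integer $n\ge 0$ and every real $x$, $$\mathcal{E}_{n,\lambda}^{Y}(x)=\sum_{j=0}^{n}\sum_{k=0}^{j}\binom{n}{j}\mathcal{E}_{n-j,\lambda}^{Y}\langle x\rangle_{k,\lambda}(-1)^{j-k}S_{1,\lambda}^{Y}(j,k).$$
   Context: $\lambda$ is a fixed nonzero real number. For real $x$ and $n\ge1$: $(x)_{n,\lambda}=x(x-\lambda)\cdots(x-(n-1)\lambda)$, $\langle x\rangle_{n,\lambda}=x(x+\lambda)\cdots(x+(n-1)\lambda)$, and $(x)_{0,\lambda}=\langle x\rangle_{0,\lambda}=1$. The degenerate exponential is $e_{\lambda}^{x}(t)=(1+\lambda t)^{x/\lambda}=\sum_{n\ge0}(x)_{n,\lambda}\frac{t^n}{n!}$. The degenerate logarithm is, for $\mu\ne0$ and $u>0$, $\log_{\mu}(u)=\frac{1}{\mu}(u^{\mu}-1)$; in particular $\log_{-\lambda}(u)=-\frac1\lambda(u^{-\lambda}-1)$. $Y$ is a real random variable whose degenerate moment generating functions exist near the origin: for every nonzero real $\lambda$ there is $r=r(\lambda)>0$ with $E[e_{\lambda}^{Y}(t)]=\sum_{n\ge0}E[(Y)_{n,\lambda}]\frac{t^n}{n!}$ for $|t|<r$. All generating-function identities are power series expansions at $t=0$. Probabilistic degenerate Stirling numbers of the first kind: $\frac{1}{k!}\big(\log_{-\lambda}(E[e_{\lambda}^{Y}(t)])\big)^k=\sum_{n\ge k}(-1)^{n-k}S_{1,\lambda}^{Y}(n,k)\frac{t^n}{n!}$, $k\ge0$.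 The probabilistic degenerate Euler polynomials associated with $Y$ are defined by $\frac{2}{E[e_{\lambda}^{Y}(t)]+1}\big(E[e_{\lambda}^{Y}(t)]\big)^{x}=\sum_{n\ge0}\mathcal{E}_{n,\lambda}^{Y}(x)\frac{t^n}{n!}$, and $\mathcal{E}_{n,\lambda}^{Y}=\mathcal{E}_{n,\lambda}^{Y}(0)$. *)

theory Defs
  imports "HOL-Probability.Probability"
begin

definition deg_falling :: "real \<Rightarrow> real \<Rightarrow> nat \<Rightarrow> real" where
  "deg_falling lam x n = (\<Prod>i<n. x - real i * lam)"

definition deg_rising :: "real \<Rightarrow> real \<Rightarrow> nat \<Rightarrow> real" where
  "deg_rising lam x n = (\<Prod>i<n. x + real i * lam)"

text \<open>As with every \<open>powr\<close> below, only positive bases are meaningful; near \<open>t = 0\<close> this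
  is no restriction.\<close>

definition deg_exp :: "real \<Rightarrow> real \<Rightarrow> real \<Rightarrow> real" where
  "deg_exp lam x t = (1 + lam * t) powr (x / lam)"

definition deg_log :: "real \<Rightarrow> real \<Rightarrow> real" where
  "deg_log \<mu> u = (u powr \<mu> - 1) / \<mu>"

definition deg_mgf :: "'a measure \<Rightarrow> ('a \<Rightarrow> real) \<Rightarrow> real \<Rightarrow> real \<Rightarrow> real" where
  "deg_mgf M Y lam t = (\<integral>\<omega>. deg_exp lam (Y \<omega>) t \<partial>M)"

text \<open>The Bochner integral of a non-integrable function is \<open>0\<close>, so the existence of the
  expectations has to be demanded separately.\<close>

definition deg_mgfs_exist :: "'a measure \<Rightarrow> ('a \<Rightarrow> real) \<Rightarrow> bool" where
  "deg_mgfs_exist M Y \<longleftrightarrow>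
     (\<forall>lam. lam \<noteq> 0 \<longrightarrow>
        (\<forall>n. integrable M (\<lambda>\<omega>. deg_falling lam (Y \<omega>) n)) \<and>
        (\<exists>r>0. \<forall>t. \<bar>t\<bar> < r \<longrightarrow>
           integrable M (\<lambda>\<omega>. deg_exp lam (Y \<omega>) t) \<and>
           (\<lambda>n. (\<integral>\<omega>. deg_falling lam (Y \<omega>) n \<partial>M) * t ^ n / fact n) sums deg_mgf M Y lam t))"

text \<open>The coefficient of \<open>t ^ n / n!\<close> in the power series expansion of \<open>f\<close> at \<open>0\<close>.\<close>

definition egf_coeff :: "(real \<Rightarrow> real) \<Rightarrow> nat \<Rightarrow> real" where
  "egf_coeff f n = fact n * fps_nth (THE F. f has_fps_expansion F) n"

lemma has_fps_expansion_real_unique: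
  fixes f :: "real \<Rightarrow> real"
  assumes "f has_fps_expansion F" "f has_fps_expansion G"
  shows "F = G"
proof (rule ccontr)
  assume "F \<noteq> G"
  define H where "H = F - G"
  define K where "K = fps_shift (subdegree H) H"
  have nz: "H \<noteq> 0" using \<open>F \<noteq> G\<close> by (simp add: H_def)
  have H: "(\<lambda>_. 0) has_fps_expansion H"
    using has_fps_expansion_diff[OF assms] by (simp add: H_def)
  then have rad: "fps_conv_radius K > 0" and ev: "\<forall>\<^sub>F t in nhds 0. eval_fps H t = 0"
    by (simp_all add: has_fps_expansion_def K_def)
  have "(eval_fps K \<longlongrightarrow> eval_fps K 0) (nhds 0)"
  proof -
    have "continuous_on (eball 0 (fps_conv_radius K)) (eval_fps K)"
      by (intro continuous_intros) auto
    moreover have "(0::real) \<in> eball 0 (fps_conv_radius K)"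
      using rad by (simp add: zero_ereal_def)
    ultimately have "isCont (eval_fps K) 0"
      by (simp add: continuous_on_eq_continuous_at)
    then show ?thesis by (simp add: isCont_def tendsto_at_iff_tendsto_nhds)
  qed
  moreover have "eval_fps K 0 \<noteq> 0"
    using nz by (simp add: K_def eval_fps_at_0)
  ultimately have "\<forall>\<^sub>F t in nhds 0. eval_fps K t \<noteq> 0"
    by (rule tendsto_imp_eventually_ne)
  moreover have "\<forall>\<^sub>F t in nhds 0. ereal (norm (t::real)) < fps_conv_radius H"
  proof -
    have "\<forall>\<^sub>F t in nhds 0. (t::real) \<in> eball 0 (fps_conv_radius H)"
      using H by (intro eventually_nhds_in_open) (auto simp: has_fps_expansion_def zero_ereal_def)
    then show ?thesis by (rule eventually_mono) (simp add: zero_ereal_def)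
  qed
  ultimately have "\<forall>\<^sub>F t in nhds 0. t = (0::real)"
    using ev
  proof eventually_elim
    case (elim t)
    then show ?case
      using eval_fps_shift[of "subdegree H" H t] by (auto simp: K_def split: if_splits)
  qed
  then have "\<forall>\<^sub>F t in at (0::real). False"
    by (simp add: eventually_at_filter)
  then show False by simp
qed

lemma egf_coeff_eq:
  assumes "f has_fps_expansion F"
  shows "egf_coeff f n = fact n * fps_nth F n"
  unfolding egf_coeff_def
  using assms has_fps_expansion_real_unique by (metis (mono_tags, lifting) the_equality)

text \<open>\<open>prob_deg_stirling1 M Y lam n k\<close> and \<open>prob_deg_euler M Y lam n x\<close> are
  \<open>S\<^sub>1(n, k)\<close> and \<open>\<E>\<^sub>n(x)\<close> for the variable \<open>Y\<close> and the parameter \<open>lam\<close>. The truncated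
  exponent \<open>n - k\<close> is immaterial for \<open>n < k\<close>, where the coefficient is \<open>0\<close> because the
  logarithm vanishes at \<open>t = 0\<close>.\<close>

definition prob_deg_stirling1 ::
    "'a measure \<Rightarrow> ('a \<Rightarrow> real) \<Rightarrow> real \<Rightarrow> nat \<Rightarrow> nat \<Rightarrow> real" where
  "prob_deg_stirling1 M Y lam n k =
     (-1) ^ (n - k) * egf_coeff (\<lambda>t. deg_log (- lam) (deg_mgf M Y lam t) ^ k / fact k) n"

definition prob_deg_euler ::
    "'a measure \<Rightarrow> ('a \<Rightarrow> real) \<Rightarrow> real \<Rightarrow> nat \<Rightarrow> real \<Rightarrow> real" where
  "prob_deg_euler M Y lam n x =
     egf_coeff (\<lambda>t. 2 / (deg_mgf M Y lam t + 1) * deg_mgf M Y lam t powr x) n"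

end

(* Near t = 0 put G(t) = E[e_lam^Y(t)] and L = log_{-lam} G. Then 1 - lam * L = G^(-lam), so the binomial
   series gives G^x = (1 - lam * L)^(-x/lam) = sum_k <x>_k L^k / k!. Multiplying by 2 / (G + 1), the
   generating function of the Euler numbers, and comparing coefficients yields the identity. *)

theory Submission
  imports Defs "HOL-Complex_Analysis.Complex_Analysis"
begin

text \<open>Complexification of a real series: it makes theorems on analytic functions applicable
  while preserving the radius of convergence and the values on the real axis.\<close>

definition fps_of_real :: "real fps \<Rightarrow> complex fps" where
  "fps_of_real F = Abs_fps (\<lambda>n. of_real (fps_nth F n))"

lemma fps_nth_of_real [simp]: "fps_nth (fps_of_real F) n = of_real (fps_nth F n)"
  by (simp add: fps_of_real_def)

lemma fps_of_real_power: "fps_of_real (F ^ k) = fps_of_real F ^ k"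
proof (induction k)
  case 0
  then show ?case by (simp add: fps_eq_iff)
next
  case (Suc k)
  have "fps_of_real (F ^ Suc k) = fps_of_real F * fps_of_real (F ^ k)"
    by (simp add: fps_eq_iff fps_mult_nth)
  with Suc show ?case by simp
qed

lemma fps_of_real_compose: "fps_of_real (F oo G) = fps_of_real F oo fps_of_real G"
  by (simp add: fps_eq_iff fps_compose_nth flip: fps_of_real_power)

lemma fps_conv_radius_of_real [simp]: "fps_conv_radius (fps_of_real F) = fps_conv_radius F"
  by (simp add: fps_conv_radius_def conv_radius_def)

lemma eval_fps_of_real:
  assumes "ereal \<bar>t\<bar> < fps_conv_radius F"
  shows "eval_fps (fps_of_real F) (of_real t) = of_real (eval_fps F t)"
proof -
  have "(\<lambda>n. fps_nth F n * t ^ n) sums eval_fps F t"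
    using assms by (intro sums_eval_fps) simp
  then have "(\<lambda>n. complex_of_real (fps_nth F n * t ^ n)) sums of_real (eval_fps F t)"
    by (rule sums_of_real)
  then show ?thesis by (simp add: eval_fps_def sums_iff)
qed

lemma eventually_nhds_in_fps_conv_radius:
  fixes F :: "real fps"
  assumes "fps_conv_radius F > 0"
  shows "\<forall>\<^sub>F t in nhds 0. ereal \<bar>t\<bar> < fps_conv_radius F"
proof -
  have "\<forall>\<^sub>F t in nhds 0. (t::real) \<in> eball 0 (fps_conv_radius F)"
    using assms by (intro eventually_nhds_in_open) (auto simp: zero_ereal_def)
  then show ?thesis by simp
qed

lemma filterlim_nhds_0_if_has_fps_expansion:
  fixes g :: "real \<Rightarrow> real"
  assumes "g has_fps_expansion G"
  shows "filterlim g (nhds (fps_nth G 0)) (nhds 0)"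
proof -
  have "filterlim g (nhds (g 0)) (nhds 0)"
    using has_fps_expansion_imp_continuous[OF assms, of UNIV]
    by (simp add: continuous_within tendsto_at_iff_tendsto_nhds)
  then show ?thesis by (simp add: has_fps_expansion_imp_0_eq_fps_nth_0[OF assms])
qed

text \<open>The library composes expansions over the complex numbers only, where analyticity is at hand.\<close>

lemma has_fps_expansion_compose_real:
  fixes f g :: "real \<Rightarrow> real"
  assumes f: "f has_fps_expansion F"
  assumes g: "g has_fps_expansion G" and G0: "fps_nth G 0 = 0"
  shows "(\<lambda>t. f (g t)) has_fps_expansion (F oo G)"
proof -
  have rF: "fps_conv_radius F > 0" and rG: "fps_conv_radius G > 0"
    and ef: "\<forall>\<^sub>F t in nhds 0. eval_fps F t = f t" and eg: "\<forall>\<^sub>F t in nhds 0. eval_fps G t = g t"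
    using f g by (auto simp: has_fps_expansion_def)
  \<comment> \<open>The sums of the complexified series are composed, which \<open>G0\<close>
    permits. This also yields the positive radius of \<open>F oo G\<close>, as complexification
    leaves radii unchanged.\<close>
  have "(eval_fps (fps_of_real F) \<circ> eval_fps (fps_of_real G)) has_fps_expansion fps_of_real (F oo G)"
    unfolding fps_of_real_compose using rF rG G0
    by (intro has_fps_expansion_compose eval_fps_has_fps_expansion) auto
  then have rFG: "fps_conv_radius (F oo G) > 0"
    and "\<forall>\<^sub>F z in nhds 0. eval_fps (fps_of_real (F oo G)) z =
           eval_fps (fps_of_real F) (eval_fps (fps_of_real G) z)"
    by (auto simp: has_fps_expansion_def)
  moreover have "filterlim complex_of_real (nhds 0) (nhds 0)"
    using tendsto_of_real[OF filterlim_ident[of "nhds (0::real)"], where 'a = complex] by simp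
  \<comment> \<open>Restriction of the complex identity to the real axis.\<close>
  ultimately have ec: "\<forall>\<^sub>F t in nhds 0. eval_fps (fps_of_real (F oo G)) (of_real t) =
           eval_fps (fps_of_real F) (eval_fps (fps_of_real G) (of_real t))"
    by (auto simp: filterlim_iff)
  have lim: "filterlim g (nhds 0) (nhds 0)"
    using filterlim_nhds_0_if_has_fps_expansion[OF g] G0 by simp
  \<comment> \<open>For small \<open>t\<close> every argument lies inside the relevant radius, so
    each complex value is the image of a real one and \<open>of_real\<close> can be
    cancelled.\<close>
  have "\<forall>\<^sub>F t in nhds 0. eval_fps (F oo G) t = f (g t)"
    using ec eg eventually_nhds_in_fps_conv_radius[OF rG] eventually_nhds_in_fps_conv_radius[OF rFG]
      eventually_compose_filterlim[OF ef lim]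
      eventually_compose_filterlim[OF eventually_nhds_in_fps_conv_radius[OF rF] lim]
  proof eventually_elim
    case (elim t)
    then have "complex_of_real (eval_fps (F oo G) t) = of_real (eval_fps F (g t))"
      by (simp add: eval_fps_of_real)
    with elim show ?case by simp
  qed
  with rFG show ?thesis by (simp add: has_fps_expansion_def)
qed

lemma has_fps_expansion_binomial_real:
  fixes a c :: real
  shows "(\<lambda>u. (1 + c * u) powr a) has_fps_expansion Abs_fps (\<lambda>k. (a gchoose k) * c ^ k)"
proof (rule has_fps_expansionI)
  \<comment> \<open>Continuity of the scaling gives the domain \<open>\<bar>c * u\<bar> < 1\<close>
    of the binomial series without dividing by \<open>c\<close>, which may be 0.\<close>
  have "filterlim (\<lambda>u. c * u) (nhds (c * 0)) (nhds 0)"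
    by (intro tendsto_intros filterlim_ident)
  moreover have "\<forall>\<^sub>F u in nhds (0::real). \<bar>u\<bar> < 1"
    using eventually_nhds_in_open[of "ball (0::real) 1" 0] by simp
  ultimately have "\<forall>\<^sub>F u in nhds 0. \<bar>c * u\<bar> < 1"
    using eventually_compose_filterlim by fastforce
  then show "\<forall>\<^sub>F u in nhds 0. (\<lambda>n. fps_nth (Abs_fps (\<lambda>k. (a gchoose k) * c ^ k)) n * u ^ n) sums (1 + c * u) powr a"
  proof eventually_elim
    case (elim u)
    show ?case using gen_binomial_real[OF elim, of a] by (simp add: power_mult_distrib mult.assoc)
  qed
qed

text \<open>Pulling \<open>lam\<close> out of every factor leaves a Pochhammer symbol at
  \<open>x / lam\<close>, which is a binomial coefficient at \<open>- x / lam\<close> up to sign.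
  Hence these are the coefficients of \<open>(1 - lam * u) powr (- x / lam)\<close>.\<close>

lemma deg_rising_conv_gbinomial:
  assumes "lam \<noteq> 0"
  shows "deg_rising lam x k / fact k = ((- x / lam) gchoose k) * (- lam) ^ k"
proof -
  have "deg_rising lam x k = (\<Prod>i<k. lam * (x / lam + real i))"
    unfolding deg_rising_def using assms by (intro prod.cong) (auto simp: field_simps)
  also have "\<dots> = lam ^ k * pochhammer (x / lam) k"
    by (simp add: prod.distrib pochhammer_prod lessThan_atLeast0)
  finally show ?thesis
    by (simp add: gbinomial_pochhammer flip: power_mult_distrib)
qed

text \<open>As \<open>G - 1\<close> has constant term 0, it can be substituted into the binomial
  series of \<open>(1 + u) powr \<mu>\<close>; the composite has constant term 1, which the
  subtraction in \<open>deg_log\<close> removes.\<close>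

lemma deg_log_has_fps_expansion:
  fixes g :: "real \<Rightarrow> real"
  assumes g: "g has_fps_expansion G" and G0: "fps_nth G 0 = 1"
  obtains L where "(\<lambda>t. deg_log \<mu> (g t)) has_fps_expansion L" "fps_nth L 0 = 0"
proof -
  \<comment> \<open>The factor \<open>1 ^ k\<close> matches the binomial expansion at
    \<open>c = 1\<close>.\<close>
  let ?B = "Abs_fps (\<lambda>k. (\<mu> gchoose k) * 1 ^ k)"
  have "(\<lambda>t. (1 + 1 * (g t - 1)) powr \<mu>) has_fps_expansion (?B oo (G - 1))"
    using g G0 by (intro has_fps_expansion_compose_real[OF has_fps_expansion_binomial_real])
      (auto intro!: fps_expansion_intros)
  then have "(\<lambda>t. (g t powr \<mu> - 1) * inverse \<mu>) has_fps_expansion ((?B oo (G - 1)) - 1) * fps_const (inverse \<mu>)"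
    by (intro has_fps_expansion_cmult_right has_fps_expansion_diff has_fps_expansion_1) auto
  then show ?thesis
    by (intro that[of "((?B oo (G - 1)) - 1) * fps_const (inverse \<mu>)"])
       (simp_all add: deg_log_def divide_inverse)
qed

text \<open>Undoing the logarithm turns the base on the right into \<open>u powr (- lam)\<close>,
  and the exponents multiply to \<open>x\<close>.\<close>

lemma powr_eq_deg_log:
  assumes "lam \<noteq> 0" "u > 0"
  shows "u powr x = (1 + (- lam) * deg_log (- lam) u) powr (- x / lam)"
  using assms by (simp add: deg_log_def powr_powr)

lemma powr_has_fps_expansion_deg_log:
  fixes g :: "real \<Rightarrow> real"
  assumes "lam \<noteq> 0" and pos: "\<forall>\<^sub>F t in nhds 0. g t > 0"
    and L: "(\<lambda>t. deg_log (- lam) (g t)) has_fps_expansion L" "fps_nth L 0 = 0"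
  shows "(\<lambda>t. g t powr x) has_fps_expansion (Abs_fps (\<lambda>k. deg_rising lam x k / fact k) oo L)"
proof -
  have "(\<lambda>t. (1 + (- lam) * deg_log (- lam) (g t)) powr (- x / lam)) has_fps_expansion
      (Abs_fps (\<lambda>k. deg_rising lam x k / fact k) oo L)"
    unfolding deg_rising_conv_gbinomial[OF \<open>lam \<noteq> 0\<close>]
    by (rule has_fps_expansion_compose_real[OF has_fps_expansion_binomial_real L])
  \<comment> \<open>An expansion depends only on values near 0, so agreement where
    \<open>g t > 0\<close> suffices.\<close>
  moreover have "\<forall>\<^sub>F t in nhds 0. (1 + (- lam) * deg_log (- lam) (g t)) powr (- x / lam) = g t powr x"
    using pos by eventually_elim (simp add: powr_eq_deg_log[OF \<open>lam \<noteq> 0\<close>, of _ x])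
  ultimately show ?thesis
    by (subst (asm) has_fps_expansion_cong[OF _ refl])
qed

text \<open>The series is part of the existence assumption; its constant term is the expectation of
  an empty product, hence the total mass 1.\<close>

lemma deg_mgf_has_fps_expansion:
  assumes "prob_space M" "deg_mgfs_exist M Y" "lam \<noteq> 0"
  obtains G where "deg_mgf M Y lam has_fps_expansion G" "fps_nth G 0 = 1"
proof -
  interpret prob_space M by fact
  let ?G = "Abs_fps (\<lambda>n. (\<integral>\<omega>. deg_falling lam (Y \<omega>) n \<partial>M) / fact n)"
  obtain r where r: "r > 0"
    and sums: "\<And>t. \<bar>t\<bar> < r \<Longrightarrow>
      (\<lambda>n. (\<integral>\<omega>. deg_falling lam (Y \<omega>) n \<partial>M) * t ^ n / fact n) sums deg_mgf M Y lam t"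
    using assms(2,3) by (auto simp: deg_mgfs_exist_def)
  have "\<forall>\<^sub>F t in nhds 0. \<bar>t\<bar> < r"
    using r eventually_nhds_in_open[of "ball 0 r" "0::real"] by simp
  then have "deg_mgf M Y lam has_fps_expansion ?G"
    by (intro has_fps_expansionI) (auto elim!: eventually_mono dest: sums)
  moreover have "fps_nth ?G 0 = 1"
    by (simp add: deg_falling_def prob_space)
  ultimately show ?thesis by (rule that)
qed

theorem theorem2p11:
  fixes M :: "'a measure" and Y :: "'a \<Rightarrow> real" and lam x :: real and n :: nat
  assumes "prob_space M"
    and "Y \<in> borel_measurable M"
    and "deg_mgfs_exist M Y"
    and "lam \<noteq> 0"
  shows "prob_deg_euler M Y lam n x =
    (\<Sum>j=0..n. \<Sum>k=0..j. real (n choose j) * prob_deg_euler M Y lam (n - j) 0 *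
       deg_rising lam x k * (-1) ^ (j - k) * prob_deg_stirling1 M Y lam j k)"
proof -
  let ?g = "deg_mgf M Y lam"
  obtain G where G: "?g has_fps_expansion G" "fps_nth G 0 = 1"
    using deg_mgf_has_fps_expansion assms by blast
  have pos: "\<forall>\<^sub>F t in nhds 0. ?g t > 0"
    using filterlim_nhds_0_if_has_fps_expansion[OF G(1)] G(2) by (simp add: order_tendsto_iff)
  obtain L where L: "(\<lambda>t. deg_log (- lam) (?g t)) has_fps_expansion L" "fps_nth L 0 = 0"
    using deg_log_has_fps_expansion[OF G] .
  define P where "P = Abs_fps (\<lambda>k. deg_rising lam x k / fact k)"
  define E where "E = 2 / (G + 1)"
  \<comment> \<open>The division is legitimate because \<open>G + 1\<close> has constant term
    2.\<close>
  have E: "(\<lambda>t. 2 / (?g t + 1)) has_fps_expansion E"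
    unfolding E_def using G by (intro fps_expansion_intros) auto
  have "(\<lambda>t. 2 / (?g t + 1) * ?g t powr x) has_fps_expansion E * (P oo L)"
    unfolding P_def
    by (intro has_fps_expansion_mult E powr_has_fps_expansion_deg_log assms pos L)
  then have euler_x: "prob_deg_euler M Y lam n x = fact n * fps_nth (E * (P oo L)) n"
    unfolding prob_deg_euler_def by (rule egf_coeff_eq)
  \<comment> \<open>Positivity matters here: \<open>0 powr 0\<close> is 0, so the factor
    \<open>?g t powr 0\<close> equals 1 only where \<open>?g t\<close> is nonzero.\<close>
  have "\<forall>\<^sub>F t in nhds 0. 2 / (?g t + 1) = 2 / (?g t + 1) * ?g t powr 0"
    using pos by eventually_elim simp
  then have "(\<lambda>t. 2 / (?g t + 1) * ?g t powr 0) has_fps_expansion E"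
    using E by (subst (asm) has_fps_expansion_cong[OF _ refl])
  then have euler_0: "prob_deg_euler M Y lam m 0 = fact m * fps_nth E m" for m
    unfolding prob_deg_euler_def by (rule egf_coeff_eq)
  \<comment> \<open>The sign cancels the one in the definition of the Stirling numbers, since their
    product is an even power of -1; this holds for the truncated exponent as well.\<close>
  have stirling: "(-1) ^ (j - k) * prob_deg_stirling1 M Y lam j k = fact j * fps_nth (L ^ k) j / fact k" for j k
  proof -
    have "(\<lambda>t. deg_log (- lam) (?g t) ^ k * inverse (fact k)) has_fps_expansion
        L ^ k * fps_const (inverse (fact k))"
      by (intro has_fps_expansion_cmult_right has_fps_expansion_power L)
    then have "egf_coeff (\<lambda>t. deg_log (- lam) (?g t) ^ k / fact k) j = fact j * fps_nth (L ^ k) j / fact k"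
      by (simp add: egf_coeff_eq field_simps)
    then show ?thesis
      by (simp add: prob_deg_stirling1_def flip: power_add mult.assoc mult_2)
  qed
  \<comment> \<open>Commuting the factors puts the index \<open>n - j\<close> on the Euler
    numbers.\<close>
  have "fps_nth (E * (P oo L)) n = (\<Sum>j=0..n. fps_nth (P oo L) j * fps_nth E (n - j))"
    by (simp add: mult.commute[of E] fps_mult_nth)
  \<comment> \<open>Splitting \<open>fact n\<close> as
    \<open>(n choose j) * fact j * fact (n - j)\<close> gives each factor its own factorial.\<close>
  also have "fact n * \<dots> = (\<Sum>j=0..n. real (n choose j) * prob_deg_euler M Y lam (n - j) 0 *
      (fact j * fps_nth (P oo L) j))"
    unfolding sum_distrib_left
    by (intro sum.cong) (auto simp: euler_0 binomial_fact field_simps)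
  \<comment> \<open>Coefficient \<open>j\<close> of \<open>P oo L\<close> involves only the powers
    \<open>L ^ k\<close> with \<open>k\<close> up to \<open>j\<close>, whence the finite inner
    sum.\<close>
  also have "\<dots> = (\<Sum>j=0..n. \<Sum>k=0..j. real (n choose j) * prob_deg_euler M Y lam (n - j) 0 *
      deg_rising lam x k * ((-1) ^ (j - k) * prob_deg_stirling1 M Y lam j k))"
    unfolding stirling fps_compose_nth P_def sum_distrib_left
    by (intro sum.cong) (auto simp: field_simps)
  finally show ?thesis
    by (simp add: euler_x mult.assoc)
qed

end
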